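(* Let $\Phi$ be a reduced crystallographic root system with simple roots $\alpha_1,\dots,\alpha_n$. Let $I\subseteq\{1,\dots,n\}$ be an arbitrary subset of modified vertices and $J=\{1,\dots,n\}\setminus I$. Then the Modified Kostant Game with active set $I$ terminates in a unique final configuration $\mathbf c^{(I)}_{final}$. Moreover, the total number of chips $|\mathbf c^{(I)}_{final}|$ in this final configuration satisfies $$|\mathbf c^{(I)}_{final}|=\sum_{\gamma^\vee\in(\Phi^\vee)^+\setminus(\Phi_J^\vee)^+}\mathrm{ht}_I(\gamma^\vee).$$
   Context: Let $E$ be a Euclidean space with inner product $\langle\cdot,\cdot\rangle$, $\Phi\subset E$ a reduced crystallographic root system with base $\alpha_1,\dots,\alpha_n$. For a root $\alpha$ the coroot is $\alpha^\vee=2\alpha/\langle\alpha,\alpha\rangle$; $\Phi^\vee$ is the set of coroots, with base $\alpha_1^\vee,\dots,\alpha_n^\vee$ and positive coroots $(\Phi^\vee)^+$. For $J\subseteq\{1,\dots,n\}$, $(\Phi_J^\vee)^+$ is the set of positive coroots lying in the span of $\{\alpha_j^\vee: j\in J\}$. For a coroot $\gamma^\vee=\sum_{j=1}^n k_j\alpha_j^\vee$, its $I$-height is $\mathrm{ht}_I(\gamma^\vee)=\sum_{j\in I}k_j$. Modified Kostant Game with active set $I$ (vertices of the Dynkin diagram of $\Phi$ are identified with $1,\dots,n$): a configuration is a vector $c=(c_1,\dots,c_n)\in\mathbb Z_{\ge0}^n$; its total number of chips is $|c|=\sum_{v=1}^n c_v$. For a vertex $v$, let $N(v)$ be the set of its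 neighbours in the Dynkin diagram, and for $u\in N(v)$ let $n_{v,u}=-\langle\alpha_u,\alpha_v^\vee\rangle$ (so $n_{v,u}=1$ if $\alpha_v$ is at least as long as $\alpha_u$, and $n_{v,u}\in\{2,3\}$, the number of edges joining $u$ and $v$, if $\alpha_v$ is shorter than $\alpha_u$). Let $\epsilon_v=1$ if $v\in I$ and $\epsilon_v=0$ otherwise. The vertex $v$ is sad in $c$ if $c_v<\tfrac12\left(\sum_{u\in N(v)}n_{v,u}c_u+\epsilon_v\right)$. A move consists of choosing a sad vertex $v$ and firing it: $c_v$ is replaced by $\sum_{u\in N(v)}n_{v,u}c_u+\epsilon_v-c_v$ and all other entries are unchanged. The game starts from $\mathbf 0$ and ends when no vertex is sad. "Terminates in a unique final configuration" means that there is no infinite sequence of moves and that every maximal sequence of moves ends in the same configuration. *)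

theory Defs
  imports "HOL-Analysis.Analysis"
begin

definition coroot :: "'a::euclidean_space \<Rightarrow> 'a" where
  "coroot \<alpha> = (2 / (\<alpha> \<bullet> \<alpha>)) *\<^sub>R \<alpha>"

text \<open>The ambient Euclidean space is a linear subspace \<open>E\<close> of a type of class
  \<^class>\<open>euclidean_space\<close>. Such a type is never zero-dimensional, so taking \<open>E\<close> to be
  the whole type would exclude the empty root system. The condition \<open>span \<Phi> = E\<close> makes
  \<open>E\<close> a subspace.\<close>

definition reduced_root_system :: "'a::euclidean_space set \<Rightarrow> 'a set \<Rightarrow> bool" where
  "reduced_root_system E \<Phi> \<longleftrightarrow>
     finite \<Phi> \<and> 0 \<notin> \<Phi> \<and> span \<Phi> = E \<and>
     (\<forall>\<alpha>\<in>\<Phi>. \<forall>\<beta>\<in>\<Phi>. \<beta> - (\<beta> \<bullet> coroot \<alpha>) *\<^sub>R \<alpha> \<in> \<Phi>) \<and>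
     (\<forall>\<alpha>\<in>\<Phi>. \<forall>\<beta>\<in>\<Phi>. \<beta> \<bullet> coroot \<alpha> \<in> \<int>) \<and>
     (\<forall>\<alpha>\<in>\<Phi>. \<forall>t::real. t *\<^sub>R \<alpha> \<in> \<Phi> \<longrightarrow> t = 1 \<or> t = -1)"

definition is_base :: "'a::euclidean_space set \<Rightarrow> 'a set \<Rightarrow> nat \<Rightarrow> (nat \<Rightarrow> 'a) \<Rightarrow> bool" where
  "is_base E \<Phi> n \<alpha> \<longleftrightarrow>
     \<alpha> ` {1..n} \<subseteq> \<Phi> \<and> inj_on \<alpha> {1..n} \<and>
     independent (\<alpha> ` {1..n}) \<and> span (\<alpha> ` {1..n}) = E \<and>
     (\<forall>\<beta>\<in>\<Phi>. \<exists>k::nat \<Rightarrow> int. \<beta> = (\<Sum>j=1..n. of_int (k j) *\<^sub>R \<alpha> j) \<and>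
        ((\<forall>j\<in>{1..n}. 0 \<le> k j) \<or> (\<forall>j\<in>{1..n}. k j \<le> 0)))"

definition pos_coroots :: "'a::euclidean_space set \<Rightarrow> nat \<Rightarrow> (nat \<Rightarrow> 'a) \<Rightarrow> 'a set" where
  "pos_coroots \<Phi> n \<alpha> =
     {\<gamma> \<in> coroot ` \<Phi>. \<exists>k::nat \<Rightarrow> nat. \<gamma> = (\<Sum>j=1..n. real (k j) *\<^sub>R coroot (\<alpha> j))}"

definition pos_coroots_on ::
    "'a::euclidean_space set \<Rightarrow> nat \<Rightarrow> (nat \<Rightarrow> 'a) \<Rightarrow> nat set \<Rightarrow> 'a set" where
  "pos_coroots_on \<Phi> n \<alpha> J = {\<gamma> \<in> pos_coroots \<Phi> n \<alpha>. \<gamma> \<in> span ((\<lambda>j. coroot (\<alpha> j)) ` J)}"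

definition I_height :: "nat \<Rightarrow> (nat \<Rightarrow> 'a::euclidean_space) \<Rightarrow> nat set \<Rightarrow> 'a \<Rightarrow> real" where
  "I_height n \<alpha> I \<gamma> =
     (\<Sum>j\<in>I. representation ((\<lambda>i. coroot (\<alpha> i)) ` {1..n}) \<gamma> (coroot (\<alpha> j)))"

definition dynkin_edges :: "(nat \<Rightarrow> 'a::euclidean_space) \<Rightarrow> nat \<Rightarrow> nat \<Rightarrow> real" where
  "dynkin_edges \<alpha> u v = (\<alpha> u \<bullet> coroot (\<alpha> v)) * (\<alpha> v \<bullet> coroot (\<alpha> u))"

definition neighbours :: "nat \<Rightarrow> (nat \<Rightarrow> 'a::euclidean_space) \<Rightarrow> nat \<Rightarrow> nat set" where
  "neighbours n \<alpha> v = {u \<in> {1..n}. u \<noteq> v \<and> dynkin_edges \<alpha> u v \<noteq> 0}"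

text \<open>The real number \<open>- (\<alpha> u \<bullet> coroot (\<alpha> v))\<close> is a natural number for distinct simple
  roots, so the conversion loses nothing: see \<open>firing_mult_exact\<close> below.\<close>

definition firing_mult :: "(nat \<Rightarrow> 'a::euclidean_space) \<Rightarrow> nat \<Rightarrow> nat \<Rightarrow> nat" where
  "firing_mult \<alpha> v u = nat \<lfloor>- (\<alpha> u \<bullet> coroot (\<alpha> v))\<rfloor>"

text \<open>A configuration is a function \<^typ>\<open>nat \<Rightarrow> nat\<close> of which only the values on \<open>{1..n}\<close>
  matter; the game starts from the zero function and never changes the other values.\<close>

definition inflow ::
    "nat \<Rightarrow> (nat \<Rightarrow> 'a::euclidean_space) \<Rightarrow> nat set \<Rightarrow> (nat \<Rightarrow> nat) \<Rightarrow> nat \<Rightarrow> nat" where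
  "inflow n \<alpha> I c v =
     (\<Sum>u\<in>neighbours n \<alpha> v. firing_mult \<alpha> v u * c u) + (if v \<in> I then 1 else 0)"

definition sad ::
    "nat \<Rightarrow> (nat \<Rightarrow> 'a::euclidean_space) \<Rightarrow> nat set \<Rightarrow> (nat \<Rightarrow> nat) \<Rightarrow> nat \<Rightarrow> bool" where
  "sad n \<alpha> I c v \<longleftrightarrow> real (c v) < 1/2 * real (inflow n \<alpha> I c v)"

text \<open>The subtraction is on \<^typ>\<open>nat\<close>, but it is never truncated when \<open>v\<close> is sad.\<close>

definition fire ::
    "nat \<Rightarrow> (nat \<Rightarrow> 'a::euclidean_space) \<Rightarrow> nat set \<Rightarrow> nat \<Rightarrow> (nat \<Rightarrow> nat) \<Rightarrow> nat \<Rightarrow> nat" where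
  "fire n \<alpha> I v c = c(v := inflow n \<alpha> I c v - c v)"

definition move ::
    "nat \<Rightarrow> (nat \<Rightarrow> 'a::euclidean_space) \<Rightarrow> nat set \<Rightarrow> (nat \<Rightarrow> nat) \<Rightarrow> (nat \<Rightarrow> nat) \<Rightarrow> bool" where
  "move n \<alpha> I c c' \<longleftrightarrow> (\<exists>v\<in>{1..n}. sad n \<alpha> I c v \<and> c' = fire n \<alpha> I v c)"

definition final_config ::
    "nat \<Rightarrow> (nat \<Rightarrow> 'a::euclidean_space) \<Rightarrow> nat set \<Rightarrow> (nat \<Rightarrow> nat) \<Rightarrow> bool" where
  "final_config n \<alpha> I c \<longleftrightarrow> (move n \<alpha> I)\<^sup>*\<^sup>* (\<lambda>_. 0) c \<and> (\<forall>v\<in>{1..n}. \<not> sad n \<alpha> I c v)"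

definition total_chips :: "nat \<Rightarrow> (nat \<Rightarrow> nat) \<Rightarrow> nat" where
  "total_chips n c = (\<Sum>v=1..n. c v)"

lemma fire_exact:
  assumes "sad n \<alpha> I c v"
  shows "int (fire n \<alpha> I v c v) = int (inflow n \<alpha> I c v) - int (c v)"
  using assms by (simp add: sad_def fire_def)

lemma firing_mult_exact:
  assumes R: "reduced_root_system E \<Phi>" and B: "is_base E \<Phi> n \<alpha>"
    and uv: "u \<in> {1..n}" "v \<in> {1..n}" "u \<noteq> v"
  shows "real (firing_mult \<alpha> v u) = - (\<alpha> u \<bullet> coroot (\<alpha> v))"
proof -
  define p where "p = \<alpha> u \<bullet> coroot (\<alpha> v)"
  have mem: "\<alpha> u \<in> \<Phi>" "\<alpha> v \<in> \<Phi>"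
    and inj: "inj_on \<alpha> {1..n}" and ind: "independent (\<alpha> ` {1..n})"
    using B uv by (auto simp: is_base_def)
  have pI: "p \<in> \<int>" and refl: "\<alpha> u - p *\<^sub>R \<alpha> v \<in> \<Phi>"
    using R mem by (auto simp: reduced_root_system_def p_def)
  obtain k :: "nat \<Rightarrow> int" where k: "\<alpha> u - p *\<^sub>R \<alpha> v = (\<Sum>j=1..n. of_int (k j) *\<^sub>R \<alpha> j)"
    and sgn: "(\<forall>j\<in>{1..n}. 0 \<le> k j) \<or> (\<forall>j\<in>{1..n}. k j \<le> 0)"
    using B refl unfolding is_base_def by blast
  define d where "d j = of_int (k j) - (if j = u then 1 else 0) + (if j = v then p else 0)" for j
  have "(\<Sum>j=1..n. d j *\<^sub>R \<alpha> j) =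
      (\<Sum>j=1..n. of_int (k j) *\<^sub>R \<alpha> j) - (\<Sum>j=1..n. if j = u then \<alpha> j else 0)
        + (\<Sum>j=1..n. if j = v then p *\<^sub>R \<alpha> j else 0)"
    unfolding sum_subtractf[symmetric] sum.distrib[symmetric]
    by (rule sum.cong) (auto simp: d_def algebra_simps)
  also have "\<dots> = 0"
    using uv k[symmetric] by simp
  finally have zero: "(\<Sum>j=1..n. d j *\<^sub>R \<alpha> j) = 0" .
  have "(\<Sum>x\<in>\<alpha> ` {1..n}. d (the_inv_into {1..n} \<alpha> x) *\<^sub>R x) = 0"
    unfolding sum.reindex[OF inj] zero[symmetric]
    by (rule sum.cong) (auto simp: the_inv_into_f_f[OF inj, simplified])
  then have "\<forall>x\<in>\<alpha> ` {1..n}. d (the_inv_into {1..n} \<alpha> x) = 0"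
    using independentD[OF ind finite_imageI[OF finite_atLeastAtMost] order_refl,
      where u = "\<lambda>x. d (the_inv_into {1..n} \<alpha> x)"] by blast
  then have d0: "d j = 0" if "j \<in> {1..n}" for j
    using that the_inv_into_f_f[OF inj that] by force
  have "k u = 1" "of_int (k v) = - p"
    using d0[OF uv(1)] d0[OF uv(2)] uv(3) by (auto simp: d_def)
  then have "p \<le> 0"
    using sgn uv by (smt (verit) of_int_0_le_iff)
  then show ?thesis
    using pI by (auto simp: firing_mult_def p_def[symmetric] elim!: Ints_cases)
qed

end

theory Submission
  imports Defs
begin

text \<open>Let \<open>\<omega>\<close> be the sum of the fundamental weights \<open>\<omega>\<^sub>i\<close> with \<open>i \<in> I\<close>, and attach to a configuration
  \<open>c\<close> the point \<open>y = \<omega> - (\<Sum>j. c\<^sub>j \<alpha>\<^sub>j)\<close>. Then \<open>v\<close> is sad iff \<open>y\<close> pairs positively with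
  \<open>\<alpha>\<^sub>v\<^sup>\<or>\<close>, and firing \<open>v\<close> reflects \<open>y\<close> in \<open>\<alpha>\<^sub>v\<close>. So the game walks down the Weyl orbit of the dominant
  weight \<open>\<omega>\<close> until it is antidominant, and an orbit contains only one antidominant element.
  Let \<open>2\<rho>\<^sup>\<or>\<close> be the sum of the positive coroots, which pairs to 2 with each simple root. Then
  \<open>2\<bar>c\<bar> = \<langle>\<omega> - y, 2\<rho>\<^sup>\<or>\<rangle>\<close>. This is bounded because all points of the orbit have the same norm, so the
  game ends. The sum of \<open>\<bar>\<langle>y, \<beta>\<^sup>\<or>\<rangle>\<bar>\<close> over all roots \<open>\<beta>\<close> is constant on the orbit, so at the final
  point \<open>\<langle>y, 2\<rho>\<^sup>\<or>\<rangle> = -\<langle>\<omega>, 2\<rho>\<^sup>\<or>\<rangle>\<close>. Hence \<open>\<bar>c\<bar> = \<langle>\<omega>, 2\<rho>\<^sup>\<or>\<rangle>\<close>, which is the sum of the \<open>I\<close>-heights.\<close>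

section \<open>Reflections and coroots in a Euclidean space\<close>

definition reflect :: "'a::euclidean_space \<Rightarrow> 'a \<Rightarrow> 'a" where
  "reflect a x = x - (x \<bullet> coroot a) *\<^sub>R a"

lemma inner_coroot_self: "a \<noteq> 0 \<Longrightarrow> a \<bullet> coroot a = 2"
  by (simp add: coroot_def)

lemma coroot_uminus: "coroot (- a) = - coroot a"
  by (simp add: coroot_def)

lemma inner_coroot: "x \<bullet> coroot a = 2 * (x \<bullet> a) / (a \<bullet> a)"
  by (simp add: coroot_def)

lemma inner_coroot_pos_iff: "a \<noteq> 0 \<Longrightarrow> 0 < x \<bullet> coroot a \<longleftrightarrow> 0 < x \<bullet> a"
  using inner_ge_zero[of a] by (auto simp: inner_coroot zero_less_divide_iff simp del: inner_ge_zero)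

lemma inner_coroot_nonneg_iff: "a \<noteq> 0 \<Longrightarrow> 0 \<le> x \<bullet> coroot a \<longleftrightarrow> 0 \<le> x \<bullet> a"
  using inner_coroot_pos_iff[of a "- x"] by (simp add: not_less[symmetric])

lemma coroot_coroot: "coroot (coroot a) = a"
  by (cases "a = 0") (simp_all add: coroot_def)

lemma inj_on_coroot: "inj_on coroot A"
  by (metis inj_onI coroot_coroot)

lemma reflect_diff: "reflect a (x - y) = reflect a x - reflect a y"
  by (simp add: reflect_def inner_diff_left algebra_simps)

lemma reflect_scaleR: "reflect a (r *\<^sub>R x) = r *\<^sub>R reflect a x"
  by (simp add: reflect_def algebra_simps)

lemma reflect_sum: "reflect a (sum f A) = (\<Sum>x\<in>A. reflect a (f x))"
  by (simp add: reflect_def inner_sum_left sum_subtractf scaleR_left.sum)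

lemma reflect_self: "reflect a a = - a"
  by (cases "a = 0") (simp_all add: reflect_def inner_coroot_self scaleR_2)

lemma reflect_reflect [simp]: "reflect a (reflect a x) = x"
  by (cases "a = 0")
    (simp_all add: reflect_def inner_diff_left inner_coroot_self algebra_simps)

lemma inner_reflect_left: "reflect a x \<bullet> y = x \<bullet> reflect a y"
  by (simp add: reflect_def coroot_def inner_diff_left inner_diff_right inner_commute)

lemma inner_reflect [simp]: "reflect a x \<bullet> reflect a y = x \<bullet> y"
  by (simp add: inner_reflect_left)

lemma reflect_coroot: "reflect a (coroot b) = coroot (reflect a b)"
  by (simp add: coroot_def reflect_scaleR)

text \<open>The family \<open>d\<close> is dual to the simple roots, so
  \<open>d j \<bullet> \<beta>\<close> reads off the j-th coefficient of a root and no expansions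
  need to be chosen. If \<open>E\<close> is a proper subspace, \<open>d\<close> is determined only
  up to vectors orthogonal to \<open>E\<close>; any choice serves.\<close>

locale based_root_system =
  fixes E \<Phi> :: "'a::euclidean_space set" and n :: nat and \<alpha> d :: "nat \<Rightarrow> 'a"
  assumes root_system: "reduced_root_system E \<Phi>"
    and base: "is_base E \<Phi> n \<alpha>"
    and dual: "\<And>i j. i \<in> {1..n} \<Longrightarrow> j \<in> {1..n} \<Longrightarrow> d i \<bullet> \<alpha> j = (if i = j then 1 else 0)"
begin

lemma finite_roots: "finite \<Phi>"
  and root_nonzero: "\<beta> \<in> \<Phi> \<Longrightarrow> \<beta> \<noteq> 0"
  and reflect_root: "\<alpha>' \<in> \<Phi> \<Longrightarrow> \<beta> \<in> \<Phi> \<Longrightarrow> reflect \<alpha>' \<beta> \<in> \<Phi>"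
  and inner_root_coroot_Ints: "\<alpha>' \<in> \<Phi> \<Longrightarrow> \<beta> \<in> \<Phi> \<Longrightarrow> \<beta> \<bullet> coroot \<alpha>' \<in> \<int>"
  and root_reduced: "\<beta> \<in> \<Phi> \<Longrightarrow> t *\<^sub>R \<beta> \<in> \<Phi> \<Longrightarrow> t = 1 \<or> t = -1"
  using root_system by (auto simp: reduced_root_system_def reflect_def)

lemma simple_root: "i \<in> {1..n} \<Longrightarrow> \<alpha> i \<in> \<Phi>"
  using base by (auto simp: is_base_def)

lemma simple_nonzero: "i \<in> {1..n} \<Longrightarrow> \<alpha> i \<noteq> 0"
  using simple_root root_nonzero by blast

lemma uminus_root: "\<beta> \<in> \<Phi> \<Longrightarrow> - \<beta> \<in> \<Phi>"
  using reflect_root[of \<beta> \<beta>] by (simp add: reflect_self)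

lemma dual_sum: "i \<in> {1..n} \<Longrightarrow> d i \<bullet> (\<Sum>j=1..n. k j *\<^sub>R \<alpha> j) = k i"
  by (simp add: inner_sum_right dual if_distrib[of "\<lambda>x. _ * x"] cong: if_cong)

lemma root_expansion:
  assumes "\<beta> \<in> \<Phi>"
  shows "\<beta> = (\<Sum>j=1..n. (d j \<bullet> \<beta>) *\<^sub>R \<alpha> j)"
    and "\<And>j. j \<in> {1..n} \<Longrightarrow> d j \<bullet> \<beta> \<in> \<int>"
    and "(\<forall>j\<in>{1..n}. 0 \<le> d j \<bullet> \<beta>) \<or> (\<forall>j\<in>{1..n}. d j \<bullet> \<beta> \<le> 0)"
proof -
  obtain k :: "nat \<Rightarrow> int" where k: "\<beta> = (\<Sum>j=1..n. of_int (k j) *\<^sub>R \<alpha> j)"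
    and sgn: "(\<forall>j\<in>{1..n}. 0 \<le> k j) \<or> (\<forall>j\<in>{1..n}. k j \<le> 0)"
    using base assms unfolding is_base_def by blast
  have dk: "d j \<bullet> \<beta> = of_int (k j)" if "j \<in> {1..n}" for j
    using dual_sum[OF that, of "\<lambda>j. of_int (k j)"] k by simp
  show "\<beta> = (\<Sum>j=1..n. (d j \<bullet> \<beta>) *\<^sub>R \<alpha> j)"
    by (subst k) (rule sum.cong, auto simp: dk)
  show "\<And>j. j \<in> {1..n} \<Longrightarrow> d j \<bullet> \<beta> \<in> \<int>"
    using dk by simp
  show "(\<forall>j\<in>{1..n}. 0 \<le> d j \<bullet> \<beta>) \<or> (\<forall>j\<in>{1..n}. d j \<bullet> \<beta> \<le> 0)"
    using sgn dk by simp
qed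

section \<open>Positive roots and their behaviour under simple reflections\<close>

definition pos_roots :: "'a set" where
  "pos_roots = {\<beta> \<in> \<Phi>. \<forall>j\<in>{1..n}. 0 \<le> d j \<bullet> \<beta>}"

lemma pos_roots_sub: "\<beta> \<in> pos_roots \<Longrightarrow> \<beta> \<in> \<Phi>"
  by (simp add: pos_roots_def)

lemma finite_pos_roots: "finite pos_roots"
  using finite_roots by (simp add: pos_roots_def)

lemma simple_pos: "i \<in> {1..n} \<Longrightarrow> \<alpha> i \<in> pos_roots"
  by (simp add: pos_roots_def simple_root dual)

lemma pos_or_neg: "\<beta> \<in> \<Phi> \<Longrightarrow> \<beta> \<in> pos_roots \<or> - \<beta> \<in> pos_roots"
  using root_expansion(3)[of \<beta>] by (auto simp: pos_roots_def uminus_root)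

lemma not_pos_and_neg: "\<beta> \<in> pos_roots \<Longrightarrow> - \<beta> \<notin> pos_roots"
proof
  assume "\<beta> \<in> pos_roots" "- \<beta> \<in> pos_roots"
  then have "\<beta> \<in> \<Phi>" and "\<And>j. j \<in> {1..n} \<Longrightarrow> d j \<bullet> \<beta> = 0"
    by (auto simp: pos_roots_def intro: antisym)
  then have "\<beta> = 0"
    using root_expansion(1)[of \<beta>] by simp
  then show False
    using \<open>\<beta> \<in> \<Phi>\<close> root_nonzero by blast
qed

lemma pos_root_inner_nonneg:
  assumes "\<beta> \<in> pos_roots" and "\<And>j. j \<in> {1..n} \<Longrightarrow> 0 \<le> x \<bullet> coroot (\<alpha> j)"
  shows "0 \<le> x \<bullet> \<beta>"
proof -
  have "0 \<le> x \<bullet> \<alpha> j" if "j \<in> {1..n}" for j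
    using assms(2)[OF that] simple_nonzero[OF that] by (simp add: inner_coroot_nonneg_iff)
  then have "0 \<le> (\<Sum>j=1..n. (d j \<bullet> \<beta>) * (x \<bullet> \<alpha> j))"
    using assms(1) by (intro sum_nonneg mult_nonneg_nonneg) (auto simp: pos_roots_def)
  then show ?thesis
    using arg_cong[OF root_expansion(1)[OF pos_roots_sub[OF assms(1)]], of "inner x"]
    by (simp add: inner_sum_right)
qed

lemma dual_reflect:
  assumes "i \<in> {1..n}" "j \<in> {1..n}" "j \<noteq> i"
  shows "d j \<bullet> reflect (\<alpha> i) \<beta> = d j \<bullet> \<beta>"
  using assms by (simp add: reflect_def inner_diff_right dual)

text \<open>The reflection changes only the i-th coefficient. If the image were negative, all other
  coefficients of \<beta> would vanish, and reducedness would leave only \<beta> =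
  \<open>\<alpha> i\<close>.\<close>

lemma reflect_pos_root:
  assumes i: "i \<in> {1..n}" and \<beta>: "\<beta> \<in> pos_roots" "\<beta> \<noteq> \<alpha> i"
  shows "reflect (\<alpha> i) \<beta> \<in> pos_roots"
proof (rule ccontr)
  assume neg: "reflect (\<alpha> i) \<beta> \<notin> pos_roots"
  have \<beta>\<Phi>: "\<beta> \<in> \<Phi>"
    using \<beta> by (simp add: pos_roots_def)
  have "- reflect (\<alpha> i) \<beta> \<in> pos_roots"
    using neg pos_or_neg reflect_root[OF simple_root[OF i] \<beta>\<Phi>] by blast
  then have "d j \<bullet> \<beta> = 0" if "j \<in> {1..n}" "j \<noteq> i" for j
    using that(1) \<beta>(1) dual_reflect[OF i that, of \<beta>] unfolding pos_roots_def
    by (metis (mono_tags, lifting) antisym inner_minus_right mem_Collect_eq neg_0_le_iff_le)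
  then have "\<beta> = (\<Sum>j=1..n. if j = i then (d i \<bullet> \<beta>) *\<^sub>R \<alpha> i else 0)"
    by (subst root_expansion(1)[OF \<beta>\<Phi>]) (rule sum.cong, auto)
  then have *: "\<beta> = (d i \<bullet> \<beta>) *\<^sub>R \<alpha> i"
    using i by simp
  then have "d i \<bullet> \<beta> = 1 \<or> d i \<bullet> \<beta> = -1"
    using root_reduced[OF simple_root[OF i]] \<beta>\<Phi> by metis
  moreover have "0 \<le> d i \<bullet> \<beta>"
    using \<beta>(1) i by (simp add: pos_roots_def)
  ultimately show False
    using * \<beta>(2) by auto
qed

subsection \<open>Positive coroots\<close>

text \<open>Otherwise -\<beta> would pair nonnegatively with every simple coroot, hence with \<beta>
  itself, contradicting \<beta> \<noteq> 0.\<close>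

lemma pos_root_descent:
  assumes "\<beta> \<in> pos_roots"
  obtains i where "i \<in> {1..n}" "0 < \<beta> \<bullet> coroot (\<alpha> i)"
proof -
  have "\<beta> \<noteq> 0" "- \<beta> \<bullet> \<beta> < 0"
    using assms root_nonzero pos_roots_sub by auto
  then obtain j where "j \<in> {1..n}" "\<not> 0 \<le> - \<beta> \<bullet> coroot (\<alpha> j)"
    using pos_root_inner_nonneg[OF assms, of "- \<beta>"] by (meson not_le)
  then show thesis
    using that[of j] by simp
qed

text \<open>Nonnegativity of the coefficients is clear; integrality is not, because the coefficients of
  \<open>\<beta>\<close> are rescaled by ratios of root lengths. It follows by reflecting \<open>\<beta>\<close> down to a simple root.\<close>

lemma coroot_pos_root:
  assumes "\<beta> \<in> pos_roots"
  shows "\<exists>k::nat \<Rightarrow> nat. coroot \<beta> = (\<Sum>j=1..n. real (k j) *\<^sub>R coroot (\<alpha> j))"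
  using assms
\<comment> \<open>The measure is the height of \<beta>: pairing with the sum of the dual family adds
  up the simple-root coefficients.\<close>
proof (induction "nat \<lfloor>(\<Sum>j=1..n. d j) \<bullet> \<beta>\<rfloor>" arbitrary: \<beta> rule: less_induct)
  case less
  define \<delta> where "\<delta> = (\<Sum>j=1..n. d j)"
  have \<beta>\<Phi>: "\<beta> \<in> \<Phi>"
    using less.prems by (rule pos_roots_sub)
  obtain i where i: "i \<in> {1..n}" and m: "0 < \<beta> \<bullet> coroot (\<alpha> i)"
    using pos_root_descent[OF less.prems] by blast
  show ?case
  proof (cases "\<beta> = \<alpha> i")
    case True
    have "coroot \<beta> = (\<Sum>j=1..n. if j = i then coroot (\<alpha> j) else 0)"
      using True i by simp
    also have "\<dots> = (\<Sum>j=1..n. real (if j = i then 1 else 0) *\<^sub>R coroot (\<alpha> j))"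
      by (rule sum.cong) auto
    finally show ?thesis
      by (rule exI[of _ "\<lambda>j. if j = i then 1 else 0"])
  next
    case False
    define \<beta>' where "\<beta>' = reflect (\<alpha> i) \<beta>"
    have pos': "\<beta>' \<in> pos_roots"
      using reflect_pos_root[OF i less.prems False] by (simp add: \<beta>'_def)
    have \<delta>i: "\<delta> \<bullet> \<alpha> i = 1"
      using i by (simp add: \<delta>_def inner_sum_left dual)
    have m1: "1 \<le> \<beta> \<bullet> coroot (\<alpha> i)"
      using m inner_root_coroot_Ints[OF simple_root[OF i] \<beta>\<Phi>]
      by (auto elim!: Ints_cases)
    have "0 \<le> \<delta> \<bullet> \<beta>'"
      using pos' by (auto simp: \<delta>_def inner_sum_left pos_roots_def intro: sum_nonneg)
    moreover have "\<delta> \<bullet> \<beta>' = \<delta> \<bullet> \<beta> - \<beta> \<bullet> coroot (\<alpha> i)"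
      by (simp add: \<beta>'_def reflect_def inner_diff_right \<delta>i)
    ultimately have "nat \<lfloor>\<delta> \<bullet> \<beta>'\<rfloor> < nat \<lfloor>\<delta> \<bullet> \<beta>\<rfloor>"
      using m1 by linarith
    then obtain k :: "nat \<Rightarrow> nat" where k: "coroot \<beta>' = (\<Sum>j=1..n. real (k j) *\<^sub>R coroot (\<alpha> j))"
      using less.hyps pos' unfolding \<delta>_def by blast
    have \<beta>: "\<beta> = reflect (\<alpha> i) \<beta>'"
      by (simp add: \<beta>'_def)
    \<comment> \<open>This is the coefficient of the i-th simple coroot gained on reflecting back
      from \<beta>' to \<beta>. It is nonnegative because the reflection made the pairing with
      \<open>\<alpha> i\<close> negative.\<close>
    define t where "t = - (\<alpha> i \<bullet> coroot \<beta>')"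
    have "0 < \<beta> \<bullet> \<alpha> i"
      using m simple_nonzero[OF i] by (simp add: inner_coroot_pos_iff)
    then have "\<alpha> i \<bullet> \<beta>' < 0"
      by (simp add: \<beta>'_def inner_reflect_left[symmetric] reflect_self inner_commute)
    then have "0 \<le> t"
      by (simp add: t_def inner_coroot divide_nonpos_nonneg)
    moreover have "t \<in> \<int>"
      using inner_root_coroot_Ints[OF pos_roots_sub[OF pos'] simple_root[OF i]]
      by (simp add: t_def)
    ultimately obtain p :: nat where p: "t = real p"
      by (metis Ints_cases int_nat_eq of_int_0_le_iff of_int_of_nat_eq)
    have "coroot \<beta> = coroot \<beta>' - (coroot \<beta>' \<bullet> coroot (\<alpha> i)) *\<^sub>R \<alpha> i"
      unfolding \<beta> reflect_coroot[symmetric] by (rule reflect_def)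
    also have "\<dots> = coroot \<beta>' + real p *\<^sub>R coroot (\<alpha> i)"
      by (simp add: p[symmetric] t_def coroot_def[of "\<alpha> i"] inner_commute)
    also have "\<dots> = coroot \<beta>' + (\<Sum>j=1..n. if j = i then real p *\<^sub>R coroot (\<alpha> j) else 0)"
      using i by simp
    also have "\<dots> = (\<Sum>j=1..n. real (k j + (if j = i then p else 0)) *\<^sub>R coroot (\<alpha> j))"
      unfolding k sum.distrib[symmetric] by (rule sum.cong) (auto simp: scaleR_add_left)
    finally show ?thesis
      by (rule exI[of _ "\<lambda>j. k j + (if j = i then p else 0)"])
  qed
qed

lemma dual_coroot_sum_nonneg:
  "i \<in> {1..n} \<Longrightarrow> 0 \<le> d i \<bullet> (\<Sum>j=1..n. real (k j) *\<^sub>R coroot (\<alpha> j))"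
  by (auto simp: inner_sum_right inner_coroot dual intro!: sum_nonneg)

text \<open>A coroot is a positive multiple of its root, so pairing with \<open>d i\<close> has the
  same sign on both. The converse inclusion uses the integrality of the coroot coefficients.\<close>

lemma pos_coroots_eq: "pos_coroots \<Phi> n \<alpha> = coroot ` pos_roots"
proof
  show "coroot ` pos_roots \<subseteq> pos_coroots \<Phi> n \<alpha>"
    using coroot_pos_root by (auto simp: pos_coroots_def pos_roots_sub)
  show "pos_coroots \<Phi> n \<alpha> \<subseteq> coroot ` pos_roots"
  proof
    fix \<gamma> assume "\<gamma> \<in> pos_coroots \<Phi> n \<alpha>"
    then obtain \<beta> k where \<beta>: "\<beta> \<in> \<Phi>" "\<gamma> = coroot \<beta>"
      and k: "\<gamma> = (\<Sum>j=1..n. real (k j) *\<^sub>R coroot (\<alpha> j))"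
      by (auto simp: pos_coroots_def)
    have "0 \<le> d i \<bullet> \<beta>" if "i \<in> {1..n}" for i
      using dual_coroot_sum_nonneg[OF that, of k] root_nonzero[OF \<beta>(1)]
      unfolding k[symmetric] \<beta>(2) by (simp add: inner_coroot_nonneg_iff)
    then show "\<gamma> \<in> coroot ` pos_roots"
      using \<beta> by (auto simp: pos_roots_def)
  qed
qed

lemma independent_simple_coroots:
  "inj_on (\<lambda>i. coroot (\<alpha> i)) {1..n}" "independent ((\<lambda>i. coroot (\<alpha> i)) ` {1..n})"
proof -
  show inj: "inj_on (\<lambda>i. coroot (\<alpha> i)) {1..n}"
    using comp_inj_on[of \<alpha> "{1..n}" coroot] base
    by (simp add: inj_on_coroot is_base_def comp_def)
  show "independent ((\<lambda>i. coroot (\<alpha> i)) ` {1..n})"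
  proof (rule independent_if_scalars_zero)
    fix f x
    assume sum: "(\<Sum>x\<in>(\<lambda>i. coroot (\<alpha> i)) ` {1..n}. f x *\<^sub>R x) = 0"
      and "x \<in> (\<lambda>i. coroot (\<alpha> i)) ` {1..n}"
    then obtain i where i: "i \<in> {1..n}" "x = coroot (\<alpha> i)"
      by blast
    have "0 = d i \<bullet> (\<Sum>j=1..n. (f (coroot (\<alpha> j)) * (2 / (\<alpha> j \<bullet> \<alpha> j))) *\<^sub>R \<alpha> j)"
      using sum unfolding sum.reindex[OF inj] by (simp add: coroot_def[of "\<alpha> _"])
    then have "f x * (2 / (\<alpha> i \<bullet> \<alpha> i)) = 0"
      unfolding i(2) using dual_sum[OF i(1)] by metis
    then show "f x = 0"
      using simple_nonzero[OF i(1)] by simp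
  qed simp
qed

section \<open>The sum of the positive coroots\<close>

definition coroot_sum :: 'a where
  "coroot_sum = (\<Sum>\<beta>\<in>pos_roots. coroot \<beta>)"

text \<open>The i-th simple reflection permutes the positive roots other than
  \<open>\<alpha> i\<close>, so it fixes the sum \<open>R\<close> of their coroots and
  \<open>R\<close> is orthogonal to \<open>\<alpha> i\<close>. The one remaining coroot contributes
  2.\<close>

lemma simple_inner_coroot_sum:
  assumes i: "i \<in> {1..n}"
  shows "\<alpha> i \<bullet> coroot_sum = 2"
proof -
  define R where "R = (\<Sum>\<beta>\<in>pos_roots - {\<alpha> i}. coroot \<beta>)"
  have maps: "reflect (\<alpha> i) \<beta> \<in> pos_roots - {\<alpha> i}" if "\<beta> \<in> pos_roots - {\<alpha> i}" for \<beta>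
  proof -
    have "reflect (\<alpha> i) \<beta> \<noteq> \<alpha> i"
      using that not_pos_and_neg[OF simple_pos[OF i]] by (metis DiffD1 reflect_reflect reflect_self)
    then show ?thesis
      using that reflect_pos_root[OF i] by blast
  qed
  have "reflect (\<alpha> i) R = (\<Sum>\<beta>\<in>pos_roots - {\<alpha> i}. coroot (reflect (\<alpha> i) \<beta>))"
    by (simp add: R_def reflect_sum reflect_coroot)
  also have "\<dots> = R"
    unfolding R_def
    by (rule sum.reindex_bij_witness[of _ "reflect (\<alpha> i)" "reflect (\<alpha> i)"]) (use maps in auto)
  finally have "reflect (\<alpha> i) R = R" .
  then have "\<alpha> i \<bullet> R = 0"
    using inner_reflect_left[of "\<alpha> i" "\<alpha> i" R] by (simp add: reflect_self)
  moreover have "coroot_sum = coroot (\<alpha> i) + R"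
    unfolding coroot_sum_def R_def by (rule sum.remove[OF finite_pos_roots simple_pos[OF i]])
  ultimately show ?thesis
    by (simp add: inner_add_right inner_coroot_self simple_nonzero[OF i])
qed

lemma sum_roots_eq:
  assumes "\<And>\<beta>. f (- \<beta>) = f \<beta>"
  shows "(\<Sum>\<beta>\<in>\<Phi>. f \<beta>) = 2 * (\<Sum>\<beta>\<in>pos_roots. f \<beta> :: real)"
proof -
  have "\<Phi> = pos_roots \<union> uminus ` pos_roots"
    using pos_or_neg pos_roots_sub uminus_root by (auto simp: image_iff) (metis minus_minus)
  moreover have "pos_roots \<inter> uminus ` pos_roots = {}"
    using not_pos_and_neg by auto
  ultimately have "(\<Sum>\<beta>\<in>\<Phi>. f \<beta>) = (\<Sum>\<beta>\<in>pos_roots. f \<beta>) + (\<Sum>\<beta>\<in>uminus ` pos_roots. f \<beta>)"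
    using finite_pos_roots by (metis sum.union_disjoint finite_imageI)
  then show ?thesis
    by (simp add: sum.reindex assms)
qed

subsection \<open>Words in the simple reflections\<close>

text \<open>Weyl group elements are represented by lists of indices, with the last letter acting
  first, so that arguments on length become inductions on lists.\<close>

definition word :: "nat list \<Rightarrow> 'a \<Rightarrow> 'a" where
  "word ws = foldr (\<lambda>i. reflect (\<alpha> i)) ws"

lemma word_simps [simp]:
  "word [] x = x" "word (i # ws) x = reflect (\<alpha> i) (word ws x)"
  "word (us @ ws) x = word us (word ws x)"
  by (simp_all add: word_def)

lemma word_rev [simp]: "word (rev ws) (word ws x) = x"
  by (induction ws arbitrary: x) simp_all

lemma inner_word [simp]: "word ws x \<bullet> word ws y = x \<bullet> y"
  by (induction ws) simp_all

lemma word_root: "set ws \<subseteq> {1..n} \<Longrightarrow> \<beta> \<in> \<Phi> \<Longrightarrow> word ws \<beta> \<in> \<Phi>"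
  by (induction ws) (simp_all add: reflect_root simple_root)

text \<open>Conjugating a reflection by an isometry gives the reflection in the image
  vector.\<close>

lemma word_reflect: "word ws (reflect b x) = reflect (word ws b) (word ws x)"
proof (induction ws)
  case (Cons i ws)
  have "reflect a (reflect b x) = reflect (reflect a b) (reflect a x)" for a b x :: 'a
  proof -
    have "reflect (reflect a b) (reflect a x) = reflect a x - (x \<bullet> coroot b) *\<^sub>R reflect a b"
      by (subst reflect_def) (simp add: reflect_coroot[symmetric])
    then show ?thesis
      by (simp add: reflect_def[of b] reflect_diff reflect_scaleR)
  qed
  then show ?case
    using Cons by simp
qed simp

text \<open>As the letters act from the right, \<open>\<alpha> k\<close> must turn negative at some
  letter \<open>i\<close>. Just before that it equals \<open>\<alpha> i\<close>, so the letters
  \<open>i\<close> and \<open>k\<close> are conjugate under the word between them and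
  cancel.\<close>

lemma exchange:
  assumes "set ws \<subseteq> {1..n}" "k \<in> {1..n}" "word ws (\<alpha> k) \<notin> pos_roots"
  shows "\<exists>us. set us \<subseteq> {1..n} \<and> length us < length ws \<and> (\<forall>x. word us x = word (ws @ [k]) x)"
  using assms
proof (induction ws)
  case Nil
  then show ?case
    using simple_pos by simp
next
  case (Cons i ws)
  show ?case
  proof (cases "word ws (\<alpha> k) \<in> pos_roots")
    case True
    \<comment> \<open>\<open>\<alpha> i\<close> is the only positive root that its own reflection
      makes negative.\<close>
    then have "word ws (\<alpha> k) = \<alpha> i"
      using Cons.prems reflect_pos_root by auto
    then have "word (i # ws @ [k]) x = word ws x" for x
      by (simp add: word_reflect)
    then show ?thesis
      using Cons.prems by (intro exI[of _ ws]) auto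
  next
    case False
    then obtain us where "set us \<subseteq> {1..n}" "length us < length ws"
      "\<forall>x. word us x = word (ws @ [k]) x"
      using Cons by auto
    then show ?thesis
      using Cons.prems by (intro exI[of _ "i # us"]) auto
  qed
qed

section \<open>Antidominant points of an orbit\<close>

definition antidominant :: "'a \<Rightarrow> bool" where
  "antidominant x \<longleftrightarrow> (\<forall>j\<in>{1..n}. x \<bullet> coroot (\<alpha> j) \<le> 0)"

lemma antidominant_pos_root: "antidominant x \<Longrightarrow> \<beta> \<in> pos_roots \<Longrightarrow> x \<bullet> \<beta> \<le> 0"
  using pos_root_inner_nonneg[of \<beta> "- x"] by (simp add: antidominant_def)

text \<open>If the last letter \<open>k\<close> of a word does not shorten it, the word sends \<open>\<alpha> k\<close> to a negative root, and
  antidominance at both ends forces \<open>\<alpha> k\<close> to be orthogonal to \<open>x\<close>, so the letter can be dropped.\<close>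

lemma antidominant_orbit_unique:
  assumes "set ws \<subseteq> {1..n}" "antidominant x" "antidominant (word ws x)"
  shows "word ws x = x"
  using assms
proof (induction "length ws" arbitrary: ws rule: less_induct)
  case less
  show ?case
  proof (cases ws rule: rev_exhaust)
    case (snoc vs k)
    have vs: "set vs \<subseteq> {1..n}" and k: "k \<in> {1..n}"
      using snoc less.prems by auto
    show ?thesis
    proof (cases "word vs (\<alpha> k) \<in> pos_roots")
      case True
      \<comment> \<open>The whole word is an isometry and sends \<open>\<alpha> k\<close> to minus
        the positive root \<open>word vs (\<alpha> k)\<close>.\<close>
      have "x \<bullet> \<alpha> k = word ws x \<bullet> word ws (\<alpha> k)"
        by simp
      also have "\<dots> = - (word ws x \<bullet> word vs (\<alpha> k))"
      proof -
        have "word ws (\<alpha> k) = reflect (word vs (\<alpha> k)) (word vs (\<alpha> k))"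
          by (simp add: snoc word_reflect)
        then show ?thesis
          by (simp add: reflect_self)
      qed
      finally have "0 \<le> x \<bullet> \<alpha> k"
        using antidominant_pos_root[OF less.prems(3) True] by simp
      moreover have "x \<bullet> \<alpha> k \<le> 0"
        using antidominant_pos_root[OF less.prems(2) simple_pos[OF k]] .
      ultimately have "reflect (\<alpha> k) x = x"
        by (simp add: reflect_def inner_coroot)
      then have "word ws x = word vs x"
        by (simp add: snoc)
      then show ?thesis
        using less.hyps[of vs] less.prems vs snoc by simp
    next
      case False
      then obtain us where "set us \<subseteq> {1..n}" "length us < length vs"
        "\<And>x. word us x = word ws x"
        using exchange[OF vs k] snoc by auto
      then show ?thesis
        using less.hyps[of us] less.prems snoc by simp
    qed
  qed simp
qed

lemma sum_abs_inner_word: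
  assumes "set ws \<subseteq> {1..n}"
  shows "(\<Sum>\<beta>\<in>\<Phi>. \<bar>word ws x \<bullet> coroot \<beta>\<bar>) = (\<Sum>\<beta>\<in>\<Phi>. \<bar>x \<bullet> coroot \<beta>\<bar>)"
  using assms
proof (induction ws)
  case (Cons i ws)
  have "(\<Sum>\<beta>\<in>\<Phi>. \<bar>word (i # ws) x \<bullet> coroot \<beta>\<bar>)
      = (\<Sum>\<beta>\<in>\<Phi>. \<bar>word ws x \<bullet> coroot (reflect (\<alpha> i) \<beta>)\<bar>)"
    by (simp add: inner_reflect_left reflect_coroot)
  also have "\<dots> = (\<Sum>\<beta>\<in>\<Phi>. \<bar>word ws x \<bullet> coroot \<beta>\<bar>)"
    by (rule sum.reindex_bij_witness[of _ "reflect (\<alpha> i)" "reflect (\<alpha> i)"])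
      (use Cons.prems in \<open>simp_all add: reflect_root simple_root\<close>)
  finally show ?case
    using Cons by simp
qed simp

text \<open>At an antidominant point all pairings with positive coroots are nonpositive, so the sum
  of absolute values over all roots is -2 times the pairing with \<open>coroot_sum\<close>. That sum
  is the same at \<open>x\<close>, at \<open>- x\<close> and at \<open>word ws x\<close>.\<close>

lemma antidominant_inner_coroot_sum:
  assumes ws: "set ws \<subseteq> {1..n}" and x: "antidominant (- x)" and wx: "antidominant (word ws x)"
  shows "word ws x \<bullet> coroot_sum = - (x \<bullet> coroot_sum)"
proof -
  have abs: "(\<Sum>\<beta>\<in>\<Phi>. \<bar>z \<bullet> coroot \<beta>\<bar>) = - 2 * (z \<bullet> coroot_sum)" if "antidominant z" for z
  proof -
    have "z \<bullet> coroot \<beta> \<le> 0" if "\<beta> \<in> pos_roots" for \<beta>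
      using antidominant_pos_root[OF \<open>antidominant z\<close> that]
      by (simp add: inner_coroot divide_nonpos_nonneg)
    then have "(\<Sum>\<beta>\<in>pos_roots. \<bar>z \<bullet> coroot \<beta>\<bar>) = - (z \<bullet> coroot_sum)"
      by (simp add: coroot_sum_def inner_sum_right sum_negf[symmetric])
    then show ?thesis
      by (subst sum_roots_eq) (simp_all add: coroot_uminus)
  qed
  show ?thesis
    using abs[OF x] abs[OF wx] sum_abs_inner_word[OF ws, of x] by simp
qed

end

subsection \<open>The game as an orbit walk\<close>

locale kostant_game = based_root_system +
  fixes I :: "nat set"
  assumes active: "I \<subseteq> {1..n}"
begin

text \<open>Rescaling \<open>d i\<close> by half the squared length of \<open>\<alpha> i\<close>
  makes it dual to the simple coroots. Up to a component orthogonal to \<open>E\<close>, this is the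
  sum of the active fundamental weights.\<close>

definition weight :: 'a where
  "weight = (\<Sum>i\<in>I. ((\<alpha> i \<bullet> \<alpha> i) / 2) *\<^sub>R d i)"

lemma weight_coroot:
  assumes "j \<in> {1..n}"
  shows "weight \<bullet> coroot (\<alpha> j) = (if j \<in> I then 1 else 0)"
proof -
  have "weight \<bullet> coroot (\<alpha> j) = (\<Sum>i\<in>I. if i = j then 1 else 0)"
    unfolding weight_def inner_sum_left
    by (rule sum.cong) (use assms active simple_nonzero in \<open>auto simp: inner_coroot dual subset_iff\<close>)
  then show ?thesis
    using finite_subset[OF active] by simp
qed

definition point :: "(nat \<Rightarrow> nat) \<Rightarrow> 'a" where
  "point c = weight - (\<Sum>j=1..n. real (c j) *\<^sub>R \<alpha> j)"

lemma point_coroot: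
  assumes v: "v \<in> {1..n}"
  shows "point c \<bullet> coroot (\<alpha> v) = real (inflow n \<alpha> I c v) - 2 * real (c v)"
proof -
  have fm: "real (firing_mult \<alpha> v u) * c u = - (real (c u) * (\<alpha> u \<bullet> coroot (\<alpha> v)))"
    if "u \<in> {1..n} - {v}" for u
    using firing_mult_exact[OF root_system base, of u v] v that by simp
  \<comment> \<open>Distinct vertices without an edge have orthogonal simple roots, because both
    factors of \<open>dynkin_edges\<close> are multiples of the same inner product.\<close>
  have zero: "real (c u) * (\<alpha> u \<bullet> coroot (\<alpha> v)) = 0"
    if "u \<in> ({1..n} - {v}) - neighbours n \<alpha> v" for u
  proof -
    have "dynkin_edges \<alpha> u v = 0"
      using that by (auto simp: neighbours_def)
    then show ?thesis
      using inner_commute[of "\<alpha> u" "\<alpha> v"] by (auto simp: dynkin_edges_def inner_coroot)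
  qed
  have "(\<Sum>u=1..n. real (c u) * (\<alpha> u \<bullet> coroot (\<alpha> v)))
      = 2 * real (c v) + (\<Sum>u\<in>{1..n} - {v}. real (c u) * (\<alpha> u \<bullet> coroot (\<alpha> v)))"
    using v by (subst sum.remove[of _ v]) (auto simp: inner_coroot_self simple_nonzero)
  also have "(\<Sum>u\<in>{1..n} - {v}. real (c u) * (\<alpha> u \<bullet> coroot (\<alpha> v)))
      = (\<Sum>u\<in>neighbours n \<alpha> v. real (c u) * (\<alpha> u \<bullet> coroot (\<alpha> v)))"
    using zero by (intro sum.mono_neutral_right ballI) (auto simp only: neighbours_def finite_Diff finite_atLeastAtMost)
  also have "\<dots> = - (\<Sum>u\<in>neighbours n \<alpha> v. real (firing_mult \<alpha> v u) * real (c u))"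
    unfolding sum_negf[symmetric] by (rule sum.cong) (use fm in \<open>auto simp: neighbours_def\<close>)
  finally show ?thesis
    by (simp add: point_def inner_diff_left inner_sum_left weight_coroot[OF v] inflow_def)
qed

lemma sad_iff: "v \<in> {1..n} \<Longrightarrow> sad n \<alpha> I c v \<longleftrightarrow> 0 < point c \<bullet> coroot (\<alpha> v)"
  by (simp add: point_coroot sad_def mult.commute)

text \<open>The new chip count at \<open>v\<close> differs from the old one by exactly
  \<open>point c \<bullet> coroot (\<alpha> v)\<close>, since the natural-number subtraction is
  exact at a sad vertex.\<close>

lemma point_fire:
  assumes v: "v \<in> {1..n}" and sad: "sad n \<alpha> I c v"
  shows "point (fire n \<alpha> I v c) = reflect (\<alpha> v) (point c)"
proof -
  have "real (fire n \<alpha> I v c v) = real (inflow n \<alpha> I c v) - real (c v)"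
    using fire_exact[OF sad] by linarith
  then have *: "real (fire n \<alpha> I v c j) = real (c j) + (if j = v then point c \<bullet> coroot (\<alpha> v) else 0)"
    for j
    by (simp add: point_coroot[OF v]) (simp add: fire_def)
  have "(\<Sum>j=1..n. real (fire n \<alpha> I v c j) *\<^sub>R \<alpha> j)
      = (\<Sum>j=1..n. real (c j) *\<^sub>R \<alpha> j)
        + (\<Sum>j=1..n. if j = v then (point c \<bullet> coroot (\<alpha> v)) *\<^sub>R \<alpha> j else 0)"
    unfolding sum.distrib[symmetric] by (rule sum.cong) (auto simp: * scaleR_add_left)
  then show ?thesis
    using v by (simp add: point_def[of "fire n \<alpha> I v c"] reflect_def) (simp add: point_def)
qed

section \<open>Chip count and termination\<close>

lemma total_chips_eq: "2 * real (total_chips n c) = (weight - point c) \<bullet> coroot_sum"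
  by (simp add: point_def total_chips_def inner_sum_left simple_inner_coroot_sum sum_distrib_left
      mult.commute)

text \<open>The vanishing outside \<open>{1..n}\<close> is recorded so that final configurations can
  later be compared as functions.\<close>

lemma reachable_word:
  assumes "(move n \<alpha> I)\<^sup>*\<^sup>* (\<lambda>_. 0) c"
  shows "(\<forall>v. v \<notin> {1..n} \<longrightarrow> c v = 0) \<and> (\<exists>ws. set ws \<subseteq> {1..n} \<and> point c = word ws weight)"
  using assms
proof (induction rule: rtranclp_induct)
  case base
  show ?case
    by (auto simp: point_def intro: exI[of _ "[]"])
next
  case (step c c')
  then obtain v ws where v: "v \<in> {1..n}" "sad n \<alpha> I c v" "c' = fire n \<alpha> I v c"
    and ws: "set ws \<subseteq> {1..n}" "point c = word ws weight"
    by (auto simp: move_def)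
  then have "point c' = word (v # ws) weight"
    by (simp add: point_fire)
  moreover have "\<forall>u. u \<notin> {1..n} \<longrightarrow> c' u = 0" "set (v # ws) \<subseteq> {1..n}"
    using step.IH v ws by (auto simp: fire_def)
  ultimately show ?case
    by blast
qed

text \<open>Firing subtracts a positive multiple of a simple root from the point, and every simple
  root pairs positively with \<open>coroot_sum\<close>.\<close>

lemma move_total_chips: "move n \<alpha> I c c' \<Longrightarrow> total_chips n c < total_chips n c'"
proof -
  assume "move n \<alpha> I c c'"
  then obtain v where v: "v \<in> {1..n}" "sad n \<alpha> I c v" "c' = fire n \<alpha> I v c"
    by (auto simp: move_def)
  then have "point c - point c' = (point c \<bullet> coroot (\<alpha> v)) *\<^sub>R \<alpha> v"
    by (simp add: point_fire reflect_def)
  then have "(point c - point c') \<bullet> coroot_sum = 2 * (point c \<bullet> coroot (\<alpha> v))"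
    by (simp only: inner_scaleR_left simple_inner_coroot_sum[OF v(1)])
  then have "2 * real (total_chips n c) < 2 * real (total_chips n c')"
    using v by (simp add: total_chips_eq sad_iff inner_diff_left)
  then show ?thesis
    by simp
qed

text \<open>All reachable points have the norm of \<open>weight\<close>, so Cauchy-Schwarz bounds
  the pairing that counts chips.\<close>

lemma total_chips_bounded:
  "\<exists>M. \<forall>c. (move n \<alpha> I)\<^sup>*\<^sup>* (\<lambda>_. 0) c \<longrightarrow> total_chips n c < M"
proof (intro exI allI impI)
  fix c assume "(move n \<alpha> I)\<^sup>*\<^sup>* (\<lambda>_. 0) c"
  then obtain ws where "point c = word ws weight"
    using reachable_word by blast
  then have "norm (point c) = norm weight"
    by (simp add: norm_eq_sqrt_inner)
  then have "norm (weight - point c) \<le> 2 * norm weight"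
    using norm_triangle_ineq4[of weight "point c"] by simp
  then have "2 * real (total_chips n c) \<le> 2 * norm weight * norm coroot_sum"
    unfolding total_chips_eq
    by (meson norm_cauchy_schwarz order_trans mult_right_mono norm_ge_zero)
  then show "total_chips n c < Suc (nat \<lfloor>norm weight * norm coroot_sum\<rfloor>)"
    by (simp add: less_Suc_eq_le le_nat_floor)
qed

lemma no_infinite_play:
  "\<nexists>f :: nat \<Rightarrow> nat \<Rightarrow> nat. f 0 = (\<lambda>_. 0) \<and> (\<forall>k. move n \<alpha> I (f k) (f (Suc k)))"
proof
  assume "\<exists>f :: nat \<Rightarrow> nat \<Rightarrow> nat. f 0 = (\<lambda>_. 0) \<and> (\<forall>k. move n \<alpha> I (f k) (f (Suc k)))"
  then obtain f where f0: "f 0 = (\<lambda>_. 0)" and f: "\<And>k. move n \<alpha> I (f k) (f (Suc k))"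
    by blast
  have "(move n \<alpha> I)\<^sup>*\<^sup>* (\<lambda>_. 0) (f k) \<and> k \<le> total_chips n (f k)" for k
  proof (induction k)
    case (Suc k)
    then show ?case
      using f[of k] move_total_chips[OF f[of k]] by (auto intro: rtranclp.rtrancl_into_rtrancl)
  qed (simp add: f0)
  then show False
    using total_chips_bounded by (meson not_less)
qed

text \<open>A reachable configuration with the most chips has no sad vertex, since firing one would
  add chips.\<close>

lemma final_exists: "\<exists>c. final_config n \<alpha> I c"
proof -
  obtain M where "\<And>c. (move n \<alpha> I)\<^sup>*\<^sup>* (\<lambda>_. 0) c \<Longrightarrow> total_chips n c < M"
    using total_chips_bounded by blast
  then obtain c where c: "(move n \<alpha> I)\<^sup>*\<^sup>* (\<lambda>_. 0) c"
    and max: "\<And>c'. (move n \<alpha> I)\<^sup>*\<^sup>* (\<lambda>_. 0) c' \<Longrightarrow> total_chips n c' \<le> total_chips n c"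
    using ex_has_greatest_nat[of "(move n \<alpha> I)\<^sup>*\<^sup>* (\<lambda>_. 0)" "\<lambda>_. 0" "total_chips n" M]
    by blast
  have "\<not> sad n \<alpha> I c v" if "v \<in> {1..n}" for v
  proof
    assume "sad n \<alpha> I c v"
    then have "move n \<alpha> I c (fire n \<alpha> I v c)"
      using that by (auto simp: move_def)
    then show False
      using max[OF rtranclp.rtrancl_into_rtrancl[OF c]] move_total_chips by fastforce
  qed
  then show ?thesis
    using c by (auto simp: final_config_def)
qed

section \<open>Uniqueness of the final configuration\<close>

lemma final_antidominant: "final_config n \<alpha> I c \<Longrightarrow> antidominant (point c)"
  by (simp add: final_config_def antidominant_def sad_iff not_less)

lemma final_unique:
  assumes c: "final_config n \<alpha> I c" and c': "final_config n \<alpha> I c'"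
  shows "c = c'"
proof
  fix v
  have r: "(move n \<alpha> I)\<^sup>*\<^sup>* (\<lambda>_. 0) c" "(move n \<alpha> I)\<^sup>*\<^sup>* (\<lambda>_. 0) c'"
    using c c' by (auto simp: final_config_def)
  obtain ws where ws: "set ws \<subseteq> {1..n}" "point c = word ws weight"
    using reachable_word[OF r(1)] by blast
  obtain ws' where ws': "set ws' \<subseteq> {1..n}" "point c' = word ws' weight"
    using reachable_word[OF r(2)] by blast
  \<comment> \<open>Going back along the first word and out along the second joins two antidominant
    points of one orbit.\<close>
  have "point c' = word (ws' @ rev ws) (point c)"
    by (simp add: ws(2) ws'(2))
  then have eq: "point c' = point c"
    using antidominant_orbit_unique[of "ws' @ rev ws" "point c"] ws(1) ws'(1)
      final_antidominant[OF c] final_antidominant[OF c'] by simp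
  show "c v = c' v"
  proof (cases "v \<in> {1..n}")
    case True
    \<comment> \<open>The dual family recovers the configuration from its point.\<close>
    have "d v \<bullet> (weight - point e) = real (e v)" for e
      using dual_sum[OF True] by (simp add: point_def)
    then show ?thesis
      using eq by (metis of_nat_eq_iff)
  next
    case False
    then show ?thesis
      using reachable_word[OF r(1)] reachable_word[OF r(2)] by simp
  qed
qed

section \<open>Heights of coroots and the final chip count\<close>

lemma I_height_eq:
  assumes "\<gamma> \<in> pos_coroots \<Phi> n \<alpha>"
  shows "I_height n \<alpha> I \<gamma> = weight \<bullet> \<gamma>"
proof -
  let ?B = "(\<lambda>i. coroot (\<alpha> i)) ` {1..n}"
  have "\<gamma> \<in> span ?B"
    using assms unfolding pos_coroots_def
    by (auto simp del: One_nat_def atLeastAtMost_iff intro!: span_sum span_scale span_base[OF imageI])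
  then have "\<gamma> = (\<Sum>b\<in>?B. representation ?B \<gamma> b *\<^sub>R b)"
    by (intro sum_representation_eq[symmetric] independent_simple_coroots) auto
  then have "weight \<bullet> \<gamma> = weight \<bullet> (\<Sum>b\<in>?B. representation ?B \<gamma> b *\<^sub>R b)"
    by simp
  \<comment> \<open>Pairing with \<open>weight\<close> is 1 on active simple coroots and 0 on the
    others, so it keeps exactly the active coefficients.\<close>
  also have "\<dots> = (\<Sum>j=1..n. if j \<in> I then representation ?B \<gamma> (coroot (\<alpha> j)) else 0)"
    unfolding inner_sum_right sum.reindex[OF independent_simple_coroots(1)]
    by (rule sum.cong) (auto simp: weight_coroot)
  also have "\<dots> = I_height n \<alpha> I \<gamma>"
    using active by (simp add: I_height_def sum.inter_restrict[symmetric] Int_absorb1)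
  finally show ?thesis
    by simp
qed

text \<open>The excluded coroots lie in the span of the inactive simple coroots, which is orthogonal
  to \<open>weight\<close>. They have I-height 0 and may be put back into the sum.\<close>

lemma sum_I_height:
  "(\<Sum>\<gamma> \<in> pos_coroots \<Phi> n \<alpha> - pos_coroots_on \<Phi> n \<alpha> ({1..n} - I). I_height n \<alpha> I \<gamma>)
    = weight \<bullet> coroot_sum"
proof -
  have "I_height n \<alpha> I \<gamma> = 0" if "\<gamma> \<in> pos_coroots_on \<Phi> n \<alpha> ({1..n} - I)" for \<gamma>
  proof -
    have "orthogonal weight \<gamma>"
      using that by (intro orthogonal_to_span[of \<gamma> "(\<lambda>j. coroot (\<alpha> j)) ` ({1..n} - I)"])
        (auto simp: pos_coroots_on_def orthogonal_def weight_coroot)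
    then show ?thesis
      using that I_height_eq by (simp add: orthogonal_def pos_coroots_on_def)
  qed
  then have "(\<Sum>\<gamma> \<in> pos_coroots \<Phi> n \<alpha> - pos_coroots_on \<Phi> n \<alpha> ({1..n} - I). I_height n \<alpha> I \<gamma>)
    = (\<Sum>\<gamma> \<in> pos_coroots \<Phi> n \<alpha>. I_height n \<alpha> I \<gamma>)"
    by (intro sum.mono_neutral_left) (auto simp: pos_coroots_eq finite_pos_roots)
  also have "\<dots> = (\<Sum>\<gamma> \<in> coroot ` pos_roots. weight \<bullet> \<gamma>)"
    using I_height_eq pos_coroots_eq by simp
  also have "\<dots> = weight \<bullet> coroot_sum"
    by (simp add: sum.reindex[OF inj_on_coroot] coroot_sum_def inner_sum_right)
  finally show ?thesis .
qed

lemma final_total_chips: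
  assumes "final_config n \<alpha> I c"
  shows "real (total_chips n c) = weight \<bullet> coroot_sum"
proof -
  obtain ws where ws: "set ws \<subseteq> {1..n}" "point c = word ws weight"
    using reachable_word assms unfolding final_config_def by blast
  have "antidominant (- weight)"
    by (simp add: antidominant_def weight_coroot)
  then have "point c \<bullet> coroot_sum = - (weight \<bullet> coroot_sum)"
    using antidominant_inner_coroot_sum[OF ws(1)] final_antidominant[OF assms] ws(2) by simp
  then show ?thesis
    using total_chips_eq[of c] by (simp add: inner_diff_left)
qed

end

text \<open>Each coordinate functional on the independent family extends to a linear functional on
  the whole space, and its adjoint at 1 is the vector representing it.\<close>

lemma dual_family_exists:
  fixes \<alpha> :: "nat \<Rightarrow> 'a::euclidean_space"
  assumes inj: "inj_on \<alpha> A" and ind: "independent (\<alpha> ` A)"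
  shows "\<exists>d. \<forall>i\<in>A. \<forall>j\<in>A. d i \<bullet> \<alpha> j = (if i = j then 1 else 0)"
proof -
  have "\<exists>e. \<forall>j\<in>A. e \<bullet> \<alpha> j = (if i = j then 1 else 0)" if i: "i \<in> A" for i
  proof -
    obtain g :: "'a \<Rightarrow> real" where g: "linear g"
      "\<forall>x\<in>\<alpha> ` A. g x = (if x = \<alpha> i then 1 else 0)"
      using linear_independent_extend[OF ind, of "\<lambda>x. if x = \<alpha> i then 1 else 0"] by auto
    have "adjoint g 1 \<bullet> \<alpha> j = (if i = j then 1 else 0)" if "j \<in> A" for j
      using adjoint_works[OF g(1), of "\<alpha> j" 1] g(2) that i inj
      by (auto simp: inner_commute inj_on_eq_iff)
    then show ?thesis
      by blast
  qed
  then show ?thesis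
    by metis
qed

theorem theorem3p10:
  fixes E \<Phi> :: "'a::euclidean_space set" and n :: nat and \<alpha> :: "nat \<Rightarrow> 'a"
    and I J :: "nat set"
  assumes "reduced_root_system E \<Phi>"
    and "is_base E \<Phi> n \<alpha>"
    and "I \<subseteq> {1..n}"
    and "J = {1..n} - I"
  shows "(\<nexists>f :: nat \<Rightarrow> nat \<Rightarrow> nat. f 0 = (\<lambda>_. 0) \<and> (\<forall>k. move n \<alpha> I (f k) (f (Suc k)))) \<and>
    (\<exists>!c. final_config n \<alpha> I c) \<and>
    (\<forall>c. final_config n \<alpha> I c \<longrightarrow>
      real (total_chips n c) =
        (\<Sum>\<gamma> \<in> pos_coroots \<Phi> n \<alpha> - pos_coroots_on \<Phi> n \<alpha> J. I_height n \<alpha> I \<gamma>))"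
proof -
  obtain d where d: "\<forall>i\<in>{1..n}. \<forall>j\<in>{1..n}. d i \<bullet> \<alpha> j = (if i = j then 1 else 0)"
    using dual_family_exists[of \<alpha> "{1..n}"] assms(2) unfolding is_base_def by blast
  interpret kostant_game E \<Phi> n \<alpha> d I
    by unfold_locales (use assms d in blast)+
  show ?thesis
    using no_infinite_play final_exists final_unique final_total_chips sum_I_height
    unfolding assms(4) by auto
qed

end
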